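(* Let $n\geq 1$ and let $M=(m_{ij})\in\mathbb{Z}^{n\times n}$ be a symmetric integer-valued matrix with binary encoding length $L$. If there exists some $\mathbf{x}\in\mathbb{R}_{\geq 0}^n$ such that $\mathbf{x}^TM\mathbf{x}<0$, then there exists a vector $\mathbf{y}\in\mathbb{R}_{\geq 0}^n$ with rational entries such that $\mathbf{y}^TM\mathbf{y}<0$ and the binary encoding length of $\mathbf{y}$ is at most $17\,L^{3/2}$.
   Context: The binary encoding length of a symmetric integer matrix $M=(m_{ij})\in\mathbb{Z}^{n\times n}$ is $$L:=\sum_{1\leq i\leq j\leq n}\Big(\big\lceil \log_2(|m_{ij}|+1)\big\rceil+1\Big),$$ i.e. only the upper triangular part is stored, with $\lceil \log_2(|m_{ij}|+1)\rceil$ bits for the absolute value of each entry and one additional bit per entry (for the sign). The binary encoding length of a non-negative rational vector $\mathbf{y}=(y_1,\dots,y_n)$ is obtained by storing each coordinate as an integer part together with the numerator and denominator of its fractional part. That is, write $y_j=a_j+\frac{p_j}{q_j}$ with integers $a_j\geq 0$, $q_j\geq 1$, $0\leq p_j<q_j$ and $\gcd(p_j,q_j)=1$ (so $p_j=0$, $q_j=1$ if $y_j$ is an integer); then the binary encoding length of $\mathbf{y}$ is $$\sum_{j=1}^n\Big(\lceil\log_2(a_j+1)\rceil+\lceil\log_2(p_j+1)\rceil+\lceil\log_2(q_j+1)\rceil\Big).$$ *)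

theory Defs
  imports Complex_Main "Jordan_Normal_Form.Matrix"
begin

definition mat_enc_length :: "int mat \<Rightarrow> int" where
  "mat_enc_length M =
    (\<Sum>j<dim_col M. \<Sum>i\<le>j. (\<lceil>log 2 (real_of_int (\<bar>M $$ (i, j)\<bar> + 1))\<rceil> + 1))"

text \<open>For a non-negative rational \<open>r = a + p/q\<close>, the integer part is \<open>a = \<lfloor>r\<rfloor>\<close>, and
  \<open>quotient_of (frac r)\<close> is the reduced fraction \<open>(p, q)\<close> with positive denominator, equal to
  \<open>(0, 1)\<close> if \<open>r\<close> is an integer. The lemmas \<open>rat_decomp\<close> and \<open>rat_decomp_unique\<close> below show
  that this is the unique decomposition with \<open>q \<ge> 1\<close>, \<open>0 \<le> p < q\<close> and \<open>gcd p q = 1\<close>.\<close>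

definition rat_enc_length :: "rat \<Rightarrow> int" where
  "rat_enc_length r =
    (let a = \<lfloor>r\<rfloor>; (p, q) = quotient_of (frac r)
     in \<lceil>log 2 (real_of_int (a + 1))\<rceil> + \<lceil>log 2 (real_of_int (p + 1))\<rceil>
        + \<lceil>log 2 (real_of_int (q + 1))\<rceil>)"

definition vec_enc_length :: "rat vec \<Rightarrow> int" where
  "vec_enc_length y = (\<Sum>j<dim_vec y. rat_enc_length (y $ j))"

lemma rat_decomp:
  assumes "r \<ge> 0" and "quotient_of (frac r) = (p, q)"
  shows "r = of_int \<lfloor>r\<rfloor> + of_int p / of_int q" "\<lfloor>r\<rfloor> \<ge> 0" "q \<ge> 1" "0 \<le> p" "p < q" "gcd p q = 1"
proof -
  have q: "q > 0" using quotient_of_denom_pos[OF assms(2)] .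
  have f: "frac r = of_int p / of_int q" using quotient_of_div[OF assms(2)] .
  show "r = of_int \<lfloor>r\<rfloor> + of_int p / of_int q" using f by (simp add: frac_def algebra_simps)
  show "\<lfloor>r\<rfloor> \<ge> 0" using assms(1) by simp
  show "q \<ge> 1" using q by simp
  have "(of_int p / of_int q :: rat) \<ge> 0" using f frac_ge_0[of r] by simp
  then show "0 \<le> p" using q by (simp add: zero_le_divide_iff)
  have "(of_int p / of_int q :: rat) < 1" using f frac_lt_1[of r] by simp
  then show "p < q" using q by (simp add: divide_less_eq)
  show "gcd p q = 1" using quotient_of_coprime[OF assms(2)] by simp
qed

lemma rat_decomp_unique:
  fixes a p q :: int
  assumes "r = of_int a + of_int p / of_int q" "q \<ge> 1" "0 \<le> p" "p < q" "gcd p q = 1"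
  shows "\<lfloor>r\<rfloor> = a" "quotient_of (frac r) = (p, q)"
proof -
  have "0 \<le> (of_int p / of_int q :: rat)" "(of_int p / of_int q :: rat) < 1"
    using assms by (auto simp: divide_less_eq)
  then show fl: "\<lfloor>r\<rfloor> = a" unfolding assms(1) by (intro floor_unique) auto
  have "frac r = of_int p / of_int q" unfolding frac_def fl using assms(1) by simp
  then have "frac r = Fract p q" by (simp add: Fract_of_int_quotient)
  then show "quotient_of (frac r) = (p, q)"
    using assms(2,5) by (simp only: quotient_of_Fract) (simp add: Rat.normalize_def)
qed

end

theory Submission
  imports Defs "Jordan_Normal_Form.Determinant"
begin

text \<open>The witness \<open>y\<close> can be taken integral, with coordinates given by Cramer's rule. Let \<open>x\<close> be a
  non-negative vector with \<open>x\<^sup>T M x < 0\<close> whose support \<open>S\<close> has the least possible size, and let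
  \<open>M\<^sub>S\<close> be the principal submatrix on \<open>S\<close>. No non-negative vector of smaller support
  takes a negative value; moving from \<open>x\<close> to the boundary of the orthant, this forces every solution
  of \<open>M\<^sub>S v = - c\<close> (the constant vector, \<open>c \<ge> 0\<close>) to be non-negative (\<open>minimal_negative_imp_nonneg\<close>). For \<open>c = 0\<close>, applied to
  \<open>v\<close> and \<open>- v\<close>, it says that \<open>M\<^sub>S\<close> is nonsingular. For \<open>c = \<bar>det M\<^sub>S\<bar>\<close>, the unique solution
  \<open>y\<close> has integer entries, is non-negative, and satisfies \<open>y\<^sup>T M y = - c (\<Sum>y) < 0\<close>.

  Up to sign, each \<open>y\<^sub>k\<close> is the determinant of \<open>M\<^sub>S\<close> with one column replaced by \<open>- 1\<close>. It is at
  most the product of the absolute row sums and hence at most \<open>\<Prod>\<^sub>i\<^sub>,\<^sub>j (1 + \<bar>m\<^sub>i\<^sub>j\<bar>)\<close>. The logarithm of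
  that product counts the bits of each off-diagonal entry twice, so one coordinate of \<open>y\<close> costs
  at most \<open>2 L\<close> bits and the whole vector at most \<open>2 n L\<close>. Since every entry of the upper triangle
  contributes a sign bit, \<open>n (n + 1) / 2 \<le> L\<close>, so \<open>n = O(\<surd>L)\<close> and the total is at most
  \<open>4 L\<^sup>3\<^sup>/\<^sup>2\<close>.\<close>

section \<open>Negative directions of minimal support\<close>

definition bilinear_form :: "'i set \<Rightarrow> ('i \<Rightarrow> 'i \<Rightarrow> 'a::comm_ring) \<Rightarrow> ('i \<Rightarrow> 'a) \<Rightarrow> ('i \<Rightarrow> 'a) \<Rightarrow> 'a" where
  "bilinear_form I m x y = (\<Sum>i\<in>I. x i * (\<Sum>j\<in>I. m i j * y j))"

definition minimal_negative :: "'i set \<Rightarrow> ('i \<Rightarrow> 'i \<Rightarrow> real) \<Rightarrow> ('i \<Rightarrow> real) \<Rightarrow> bool" where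
  "minimal_negative I m x \<longleftrightarrow> (\<forall>i\<in>I. 0 \<le> x i) \<and> bilinear_form I m x x < 0 \<and>
     (\<forall>b. (\<forall>i\<in>I. 0 \<le> b i) \<and> bilinear_form I m b b < 0
        \<longrightarrow> card {i\<in>I. x i \<noteq> 0} \<le> card {i\<in>I. b i \<noteq> 0})"

lemma minimal_negative_exists:
  assumes "\<forall>i\<in>I. 0 \<le> x i" and "bilinear_form I m x x < 0"
  shows "\<exists>x'. minimal_negative I m x'"
proof -
  obtain x' where "(\<forall>i\<in>I. 0 \<le> x' i) \<and> bilinear_form I m x' x' < 0"
    and "\<forall>b. (\<forall>i\<in>I. 0 \<le> b i) \<and> bilinear_form I m b b < 0
           \<longrightarrow> card {i\<in>I. x' i \<noteq> 0} \<le> card {i\<in>I. b i \<noteq> 0}"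
    using ex_has_least_nat[of "\<lambda>x. (\<forall>i\<in>I. 0 \<le> x i) \<and> bilinear_form I m x x < 0" x
        "\<lambda>x. card {i\<in>I. x i \<noteq> 0}"] assms
    by blast
  then show ?thesis unfolding minimal_negative_def by blast
qed

lemma bilinear_form_commute:
  fixes m :: "'i \<Rightarrow> 'i \<Rightarrow> 'a::comm_ring"
  assumes "\<And>i j. i \<in> I \<Longrightarrow> j \<in> I \<Longrightarrow> m i j = m j i"
  shows "bilinear_form I m x y = bilinear_form I m y x"
proof -
  have "bilinear_form I m x y = (\<Sum>i\<in>I. \<Sum>j\<in>I. x i * (m i j * y j))"
    unfolding bilinear_form_def by (simp add: sum_distrib_left)
  also have "\<dots> = (\<Sum>j\<in>I. \<Sum>i\<in>I. x i * (m i j * y j))"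
    by (rule sum.swap)
  also have "\<dots> = (\<Sum>j\<in>I. \<Sum>i\<in>I. y j * (m j i * x i))"
    using assms by (intro sum.cong refl) (metis mult.left_commute mult.commute)
  also have "\<dots> = bilinear_form I m y x"
    unfolding bilinear_form_def by (simp add: sum_distrib_left)
  finally show ?thesis .
qed

lemma bilinear_form_add_scaled_left:
  "bilinear_form I m (\<lambda>i. x i + t * v i) y
     = bilinear_form I m x y + t * bilinear_form I m v y"
  unfolding bilinear_form_def
  by (simp add: algebra_simps sum.distrib sum_distrib_left)

lemma bilinear_form_add_scaled_right:
  "bilinear_form I m y (\<lambda>i. x i + t * v i)
     = bilinear_form I m y x + t * bilinear_form I m y v"
  unfolding bilinear_form_def
  by (simp add: algebra_simps sum.distrib sum_distrib_left)

lemma bilinear_form_constant_image: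
  assumes "\<And>i. i \<in> I \<Longrightarrow> b i \<noteq> 0 \<Longrightarrow> (\<Sum>j\<in>I. m i j * v j) = - c"
  shows "bilinear_form I m b v = - (c * sum b I)"
proof -
  have "bilinear_form I m b v = (\<Sum>i\<in>I. - c * b i)"
    unfolding bilinear_form_def
    by (rule sum.cong[OF refl]) (use assms in \<open>force simp: mult.commute\<close>)
  then show ?thesis by (simp add: sum_distrib_left sum_negf)
qed

text \<open>If \<open>v\<close> had a negative entry, the ray from \<open>x\<close> in direction \<open>v\<close> would leave the
  non-negative orthant, first touching its boundary at some \<open>b = x + t v\<close> of smaller support.
  For the quadratic form \<open>q\<close> of \<open>m\<close>, up to that point the value does not exceed \<open>q x\<close>,
  because \<open>q b = q x - t c (\<Sum>x) - t c (\<Sum>b)\<close>. So \<open>b\<close> would contradict the minimality of \<open>x\<close>. The case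
  \<open>c = 0\<close> is included because it yields the nonsingularity of the matrix on the support.\<close>

lemma minimal_negative_imp_nonneg:
  assumes I: "finite I"
    and sym: "\<And>i j. i \<in> I \<Longrightarrow> j \<in> I \<Longrightarrow> m i j = m j i"
    and min: "minimal_negative I m x"
    and v0: "\<And>i. i \<in> I \<Longrightarrow> x i = 0 \<Longrightarrow> v i = 0"
    and img: "\<And>i. i \<in> I \<Longrightarrow> x i \<noteq> 0 \<Longrightarrow> (\<Sum>j\<in>I. m i j * v j) = - c"
    and c: "0 \<le> c"
    and k: "k \<in> I"
  shows "0 \<le> v k"
proof (rule ccontr)
  assume "\<not> 0 \<le> v k"
  define N where "N = {i\<in>I. v i < 0}"
  define t where "t = Min ((\<lambda>i. x i / (- v i)) ` N)"
  define b where "b = (\<lambda>i. x i + t * v i)"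
  have x: "\<And>i. i \<in> I \<Longrightarrow> 0 \<le> x i" and neg: "bilinear_form I m x x < 0"
    using min unfolding minimal_negative_def by auto
  have N: "finite N" "N \<noteq> {}"
    using I k \<open>\<not> 0 \<le> v k\<close> unfolding N_def by auto
  have "t \<in> (\<lambda>i. x i / (- v i)) ` N"
    unfolding t_def using N by (intro Min_in) auto
  then obtain l where l: "l \<in> N" "t = x l / (- v l)" by blast
  have t_le: "t \<le> x i / (- v i)" if "i \<in> N" for i
    unfolding t_def using N that by (intro Min_le) auto
  have t: "0 \<le> t"
    using l x[of l] unfolding N_def by (auto simp: zero_le_divide_iff divide_nonneg_neg)
  have b: "0 \<le> b i" if "i \<in> I" for i
  proof (cases "v i < 0")
    case True
    then show ?thesis
      using t_le[of i] that unfolding N_def b_def by (simp add: field_simps)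
  next
    case False
    then show ?thesis using t x[OF that] unfolding b_def by simp
  qed
  have b0: "x i \<noteq> 0" if "i \<in> I" "b i \<noteq> 0" for i
    using that v0[of i] unfolding b_def by auto
  have "bilinear_form I m b b = bilinear_form I m x b + t * bilinear_form I m v b"
    unfolding b_def by (rule bilinear_form_add_scaled_left)
  also have "bilinear_form I m x b = bilinear_form I m x x + t * bilinear_form I m x v"
    unfolding b_def by (rule bilinear_form_add_scaled_right)
  also have "bilinear_form I m v b = bilinear_form I m b v"
    by (rule bilinear_form_commute[OF sym])
  also have "bilinear_form I m b v = - (c * sum b I)"
    by (rule bilinear_form_constant_image) (use b0 img in blast)
  also have "bilinear_form I m x v = - (c * sum x I)"
    by (rule bilinear_form_constant_image) (use img in blast)
  finally have "bilinear_form I m b b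
      = bilinear_form I m x x - t * (c * sum x I) - t * (c * sum b I)"
    by simp
  moreover have "0 \<le> t * (c * sum x I)" "0 \<le> t * (c * sum b I)"
    using t c x b by (auto intro!: mult_nonneg_nonneg sum_nonneg)
  ultimately have "bilinear_form I m b b < 0" using neg by linarith
  then have "card {i\<in>I. x i \<noteq> 0} \<le> card {i\<in>I. b i \<noteq> 0}"
    using min b unfolding minimal_negative_def by blast
  moreover have "{i\<in>I. b i \<noteq> 0} \<subset> {i\<in>I. x i \<noteq> 0}"
  proof -
    have "l \<in> I" "v l < 0" using l(1) unfolding N_def by auto
    then have "x l \<noteq> 0" "b l = 0"
      using v0[of l] l(2) unfolding b_def by (auto simp: field_simps)
    then show ?thesis using b0 \<open>l \<in> I\<close> by blast
  qed
  then have "card {i\<in>I. b i \<noteq> 0} < card {i\<in>I. x i \<noteq> 0}"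
    using I by (intro psubset_card_mono) auto
  ultimately show False by linarith
qed

lemma minimal_negative_imp_kernel_trivial:
  assumes I: "finite I"
    and sym: "\<And>i j. i \<in> I \<Longrightarrow> j \<in> I \<Longrightarrow> m i j = m j i"
    and min: "minimal_negative I m x"
    and v0: "\<And>i. i \<in> I \<Longrightarrow> x i = 0 \<Longrightarrow> v i = 0"
    and img: "\<And>i. i \<in> I \<Longrightarrow> x i \<noteq> 0 \<Longrightarrow> (\<Sum>j\<in>I. m i j * v j) = 0"
    and k: "k \<in> I"
  shows "v k = 0"
proof -
  have "0 \<le> v k"
    by (rule minimal_negative_imp_nonneg[OF I sym min _ _ order.refl k])
      (use v0 img in auto)
  moreover have "0 \<le> (\<lambda>i. - v i) k"
    by (rule minimal_negative_imp_nonneg[OF I sym min _ _ order.refl k])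
      (use v0 img in \<open>auto simp: sum_negf\<close>)
  ultimately show ?thesis by simp
qed

section \<open>An entrywise bound for determinants\<close>

text \<open>Multiplying out the product of the row sums gives one term for every function from rows
  to columns; the permutations in the Leibniz formula are among these functions.\<close>

lemma abs_det_le_prod_row_sums:
  fixes A :: "'a::linordered_idom mat"
  assumes A: "A \<in> carrier_mat n n"
  shows "\<bar>det A\<bar> \<le> (\<Prod>i<n. \<Sum>j<n. \<bar>A $$ (i, j)\<bar>)"
proof -
  let ?P = "{p. p permutes {0..<n}}"
  let ?f = "\<lambda>g. \<Prod>i<n. \<bar>A $$ (i, g i)\<bar>"
  have "\<bar>det A\<bar> \<le> (\<Sum>p\<in>?P. \<bar>signof p * (\<Prod>i=0..<n. A $$ (i, p i))\<bar>)"
    unfolding det_def'[OF A] by (rule sum_abs)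
  also have "\<dots> = (\<Sum>p\<in>?P. ?f (restrict p {..<n}))"
    by (intro sum.cong refl) (auto simp: abs_mult abs_prod sign_def atLeast0LessThan intro!: prod.cong)
  also have "\<dots> = sum ?f ((\<lambda>p. restrict p {..<n}) ` ?P)"
  proof (rule sum.reindex[unfolded comp_def, symmetric])
    show "inj_on (\<lambda>p. restrict p {..<n}) ?P"
    proof (rule inj_onI, rule ext)
      fix p q i
      assume p: "p \<in> ?P" and q: "q \<in> ?P" and eq: "restrict p {..<n} = restrict q {..<n}"
      show "p i = q i"
      proof (cases "i < n")
        case True
        then show ?thesis using fun_cong[OF eq, of i] by simp
      next
        case False
        then show ?thesis using p q by (simp add: permutes_def)
      qed
    qed
  qed
  also have "\<dots> \<le> sum ?f (PiE {..<n} (\<lambda>_. {..<n}))"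
  proof (rule sum_mono2)
    show "finite (PiE {..<n} (\<lambda>_. {..<n}))" by (intro finite_PiE) auto
    show "(\<lambda>p. restrict p {..<n}) ` ?P \<subseteq> PiE {..<n} (\<lambda>_. {..<n})"
    proof (intro image_subsetI restrict_PiE_iff[THEN iffD2] ballI)
      fix p i assume "p \<in> ?P" "i \<in> {..<n}"
      then show "p i \<in> {..<n}" using permutes_in_image[of p "{0..<n}" i] by auto
    qed
  qed (auto intro: prod_nonneg)
  also have "\<dots> = (\<Prod>i<n. \<Sum>j<n. \<bar>A $$ (i, j)\<bar>)"
    by (rule prod_sum_PiE[symmetric]) auto
  finally show ?thesis .
qed

lemma one_plus_sum_le_prod:
  fixes f :: "'i \<Rightarrow> 'a::linordered_idom"
  assumes "finite J" and "\<And>j. j \<in> J \<Longrightarrow> 0 \<le> f j"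
  shows "1 + sum f J \<le> (\<Prod>j\<in>J. 1 + f j)"
  using assms
proof (induction J rule: finite_induct)
  case (insert k J)
  have "1 + sum f (insert k J) \<le> (1 + f k) * (1 + sum f J)"
    using insert.hyps insert.prems
    by (simp add: algebra_simps sum_nonneg)
  also have "\<dots> \<le> (1 + f k) * (\<Prod>j\<in>J. 1 + f j)"
    using insert.IH insert.prems by (intro mult_left_mono) (auto simp: add_nonneg_nonneg)
  finally show ?case using insert.hyps by simp
qed simp

section \<open>Integer witnesses from Cramer's rule\<close>

text \<open>Filling up the principal submatrix on \<open>S\<close> with an identity block keeps its determinant and
  the solutions of the linear systems of interest, without renumbering the rows and columns.\<close>

definition identity_outside :: "nat set \<Rightarrow> 'a::{zero,one} mat \<Rightarrow> 'a mat" where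
  "identity_outside S M = mat (dim_row M) (dim_col M)
     (\<lambda>(i, j). if i \<in> S \<and> j \<in> S then M $$ (i, j) else if i = j then 1 else 0)"

lemma identity_outside_carrier [simp]:
  "M \<in> carrier_mat n n \<Longrightarrow> identity_outside S M \<in> carrier_mat n n"
  unfolding identity_outside_def by auto

lemma identity_outside_mult_vec:
  fixes M :: "'a::comm_ring_1 mat"
  assumes M: "M \<in> carrier_mat n n" and v: "v \<in> carrier_vec n" and i: "i < n"
  shows "(identity_outside S M *\<^sub>v v) $ i =
    (if i \<in> S then (\<Sum>j<n. M $$ (i, j) * (if j \<in> S then v $ j else 0)) else v $ i)"
proof -
  have "(identity_outside S M *\<^sub>v v) $ i
      = (\<Sum>j<n. (if i \<in> S \<and> j \<in> S then M $$ (i, j) else if i = j then 1 else 0) * v $ j)"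
    using M v i unfolding identity_outside_def
    by (auto simp: scalar_prod_def atLeast0LessThan intro!: sum.cong)
  also have "\<dots> = (if i \<in> S then (\<Sum>j<n. M $$ (i, j) * (if j \<in> S then v $ j else 0)) else v $ i)"
  proof (cases "i \<in> S")
    case True
    then show ?thesis by (auto intro!: sum.cong)
  next
    case False
    have "(\<Sum>j<n. (if i = j then 1 else 0) * v $ j) = (\<Sum>j<n. if i = j then v $ j else 0)"
      by (intro sum.cong) auto
    then show ?thesis using False i by simp
  qed
  finally show ?thesis .
qed

text \<open>The absolute sum of row \<open>i\<close> exceeds that of row \<open>i\<close> of \<open>M\<close> by at most \<open>1\<close>: for \<open>i \<in> S\<close> the
  excess comes from the replaced column, and for \<open>i \<notin> S\<close> from the unit entry on the diagonal,
  because \<open>b\<close> vanishes there.\<close>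

lemma abs_det_replace_col_le:
  fixes M :: "int mat"
  assumes M: "M \<in> carrier_mat n n"
    and b: "\<And>i. i < n \<Longrightarrow> \<bar>b $ i\<bar> \<le> (if i \<in> S then 1 else 0)"
  shows "\<bar>det (replace_col (identity_outside S M) b k)\<bar> \<le> (\<Prod>i<n. \<Prod>j<n. 1 + \<bar>M $$ (i, j)\<bar>)"
proof -
  let ?C = "replace_col (identity_outside S M) b k"
  have C: "?C \<in> carrier_mat n n" using M unfolding replace_col_def identity_outside_def by auto
  have "\<bar>det ?C\<bar> \<le> (\<Prod>i<n. \<Sum>j<n. \<bar>?C $$ (i, j)\<bar>)"
    by (rule abs_det_le_prod_row_sums[OF C])
  also have "\<dots> \<le> (\<Prod>i<n. \<Prod>j<n. 1 + \<bar>M $$ (i, j)\<bar>)"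
  proof (rule prod_mono, intro conjI)
    fix i assume "i \<in> {..<n}"
    then have i: "i < n" by simp
    show "0 \<le> (\<Sum>j<n. \<bar>?C $$ (i, j)\<bar>)" by (simp add: sum_nonneg)
    have C_entry: "?C $$ (i, j) = (if j = k then b $ i else
        if i \<in> S \<and> j \<in> S then M $$ (i, j) else if i = j then 1 else 0)" if "j < n" for j
      using M i that unfolding replace_col_def identity_outside_def by auto
    have "(\<Sum>j<n. \<bar>?C $$ (i, j)\<bar>) \<le> 1 + (\<Sum>j<n. \<bar>M $$ (i, j)\<bar>)"
    proof -
      \<comment> \<open>\<open>?h\<close> is the one column in which row \<open>i\<close> may have a unit entry not coming from \<open>M\<close>.\<close>
      let ?h = "if i \<in> S then k else i"
      have "(\<Sum>j<n. \<bar>?C $$ (i, j)\<bar>) \<le> (\<Sum>j<n. (if j = ?h then 1 else 0) + \<bar>M $$ (i, j)\<bar>)"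
        by (rule sum_mono) (use b[OF i] C_entry in \<open>auto split: if_splits\<close>)
      also have "\<dots> \<le> 1 + (\<Sum>j<n. \<bar>M $$ (i, j)\<bar>)"
        by (simp add: sum.distrib)
      finally show ?thesis .
    qed
    also have "\<dots> \<le> (\<Prod>j<n. 1 + \<bar>M $$ (i, j)\<bar>)"
      by (rule one_plus_sum_le_prod) auto
    finally show "(\<Sum>j<n. \<bar>?C $$ (i, j)\<bar>) \<le> (\<Prod>j<n. 1 + \<bar>M $$ (i, j)\<bar>)" .
  qed
  finally show ?thesis .
qed

lemma det_identity_outside_nonzero:
  fixes M :: "real mat"
  assumes M: "M \<in> carrier_mat n n"
    and sym: "\<And>i j. i < n \<Longrightarrow> j < n \<Longrightarrow> M $$ (i, j) = M $$ (j, i)"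
    and min: "minimal_negative {..<n} (\<lambda>i j. M $$ (i, j)) x"
    and S: "S = {i. i < n \<and> x i \<noteq> 0}"
  shows "det (identity_outside S M) \<noteq> 0"
proof
  let ?B = "identity_outside S M"
  assume "det ?B = 0"
  then obtain v where v: "v \<in> carrier_vec n" "v \<noteq> 0\<^sub>v n" "?B *\<^sub>v v = 0\<^sub>v n"
    using det_0_iff_vec_prod_zero[of ?B n] M by auto
  have Bv: "(if i \<in> S then (\<Sum>j<n. M $$ (i, j) * (if j \<in> S then v $ j else 0)) else v $ i) = 0"
    if "i < n" for i
    using identity_outside_mult_vec[OF M v(1) that, of S, symmetric] v(3) that by simp
  have off: "v $ i = 0" if "i < n" "i \<notin> S" for i
    using Bv[of i] that by simp
  have "v $ i = 0" if "i < n" for i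
  proof (rule minimal_negative_imp_kernel_trivial[OF _ _ min, where v = "\<lambda>i. v $ i"])
    fix i assume i: "i \<in> {..<n}" "x i \<noteq> 0"
    have "(\<Sum>j<n. M $$ (i, j) * v $ j) = (\<Sum>j<n. M $$ (i, j) * (if j \<in> S then v $ j else 0))"
      by (rule sum.cong) (use off in auto)
    also have "\<dots> = 0" using Bv[of i] i S by simp
    finally show "(\<Sum>j<n. M $$ (i, j) * v $ j) = 0" .
  qed (use sym off S that in auto)
  then have "v = 0\<^sub>v n" using v(1) by auto
  with v(2) show False by simp
qed

text \<open>With \<open>d\<close> the determinant of the principal submatrix on the support of a minimal negative
  vector, the witness is the solution of \<open>M y = - \<bar>d\<bar>\<close> on this support. The scaling by \<open>\<bar>d\<bar>\<close>
  clears the denominators in Cramer's rule; taking \<open>\<bar>d\<bar>\<close> and not \<open>d\<close> keeps the right-hand side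
  negative, as the non-negativity of \<open>y\<close> requires.\<close>

lemma bounded_integer_witness:
  fixes M :: "int mat"
  assumes M: "M \<in> carrier_mat n n"
    and sym: "\<And>i j. i < n \<Longrightarrow> j < n \<Longrightarrow> M $$ (i, j) = M $$ (j, i)"
    and x: "\<And>i. i < n \<Longrightarrow> 0 \<le> x i"
    and neg: "bilinear_form {..<n} (\<lambda>i j. real_of_int (M $$ (i, j))) x x < 0"
  obtains y :: "nat \<Rightarrow> int"
  where "\<And>i. i < n \<Longrightarrow> 0 \<le> y i"
    and "\<And>i. i < n \<Longrightarrow> y i \<le> (\<Prod>i<n. \<Prod>j<n. 1 + \<bar>M $$ (i, j)\<bar>)"
    and "bilinear_form {..<n} (\<lambda>i j. M $$ (i, j)) y y < 0"
proof -
  let ?m = "\<lambda>i j. real_of_int (M $$ (i, j))"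
  obtain z where min: "minimal_negative {..<n} ?m z"
    using minimal_negative_exists[of "{..<n}" x ?m] x neg by auto
  define S where "S = {i. i < n \<and> z i \<noteq> 0}"
  define R where "R = (map_mat of_int M :: real mat)"
  define B where "B = identity_outside S M"
  define A where "A = identity_outside S R"
  define b where "b = vec n (\<lambda>i. if i \<in> S then - 1 else 0 :: int)"
  define d where "d = det B"
  define y where "y = (\<lambda>k. sgn d * det (replace_col B b k))"
  have R: "R \<in> carrier_mat n n" using M unfolding R_def by auto
  have R_entry: "R $$ (i, j) = ?m i j" if "i < n" "j < n" for i j
    using M that unfolding R_def by auto
  have B: "B \<in> carrier_mat n n" and A: "A \<in> carrier_mat n n"
    using M R unfolding A_def B_def by auto
  have A_eq: "A = map_mat of_int B"
    unfolding A_def B_def identity_outside_def R_def using M by (intro eq_matI) auto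
  have det_A: "det A = of_int d"
    unfolding A_eq d_def by (simp add: of_int_hom.hom_det)
  have sum_cong: "(\<And>j. j < n \<Longrightarrow> f j = g j) \<Longrightarrow> sum f {..<n} = sum g {..<n}"
    for f g :: "nat \<Rightarrow> real" by (rule sum.cong) auto
  have min_R: "minimal_negative {..<n} (\<lambda>i j. R $$ (i, j)) z"
  proof -
    have "bilinear_form {..<n} (\<lambda>i j. R $$ (i, j)) u u = bilinear_form {..<n} ?m u u" for u
      unfolding bilinear_form_def by (intro sum.cong arg_cong2[where f = "(*)"]) (auto simp: R_entry)
    then show ?thesis using min unfolding minimal_negative_def by simp
  qed
  have "det A \<noteq> 0"
    unfolding A_def
    by (rule det_identity_outside_nonzero[OF R _ min_R S_def]) (simp add: R_entry sym)
  then have d: "d \<noteq> 0" using det_A by simp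

  define u where "u = (1 / det A) \<cdot>\<^sub>v (adj_mat A *\<^sub>v map_vec of_int b)"
  have bR: "map_vec of_int b \<in> carrier_vec n" unfolding b_def by simp
  have u: "u \<in> carrier_vec n"
    using adj_mat(1)[OF A] bR unfolding u_def by auto
  have "A *\<^sub>v (adj_mat A *\<^sub>v map_vec of_int b) = (A * adj_mat A) *\<^sub>v map_vec of_int b"
    using assoc_mult_mat_vec[OF A adj_mat(1)[OF A] bR] by simp
  also have "\<dots> = det A \<cdot>\<^sub>v map_vec of_int b"
    unfolding adj_mat(2)[OF A] using bR by (intro eq_vecI) (auto simp: row_smult smult_scalar_prod_distrib)
  finally have adj_b: "A *\<^sub>v (adj_mat A *\<^sub>v map_vec of_int b) = det A \<cdot>\<^sub>v map_vec of_int b" .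
  have "A *\<^sub>v u = map_vec of_int b"
    using \<open>det A \<noteq> 0\<close> A bR adj_mat(1)[OF A] unfolding u_def
    by (simp add: mult_mat_vec[of A n n] adj_b smult_smult_assoc)
  have y_u: "real_of_int (y k) = \<bar>real_of_int d\<bar> * u $ k" if "k < n" for k
  proof -
    have "replace_col A (map_vec of_int b) k = map_mat of_int (replace_col B b k)"
      unfolding A_eq replace_col_def using B by (intro eq_matI) (auto simp: b_def)
    then have "real_of_int (det (replace_col B b k)) = det (replace_col A (A *\<^sub>v u) k)"
      unfolding \<open>A *\<^sub>v u = map_vec of_int b\<close> by (simp add: of_int_hom.hom_det)
    also have "\<dots> = u $ k * real_of_int d"
      using cramer_lemma_mat[OF A u that] det_A by simp
    finally have "real_of_int (y k) = real_of_int (sgn d) * real_of_int d * u $ k"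
      unfolding y_def by simp
    then show ?thesis by (simp add: sgn_if split: if_splits)
  qed
  have Au: "(if i \<in> S then (\<Sum>j<n. R $$ (i, j) * (if j \<in> S then u $ j else 0)) else u $ i)
      = (if i \<in> S then - 1 else 0)" if "i < n" for i
    unfolding identity_outside_mult_vec[OF R u that, of S, symmetric]
    using \<open>A *\<^sub>v u = map_vec of_int b\<close> that
    unfolding A_def[symmetric] b_def by simp
  have u_off: "u $ i = 0" if "i < n" "i \<notin> S" for i
    using Au[of i] that by simp
  have img: "(\<Sum>j<n. ?m i j * real_of_int (y j)) = - \<bar>real_of_int d\<bar>" if "i < n" "i \<in> S" for i
  proof -
    have "(\<Sum>j<n. ?m i j * real_of_int (y j))
        = (\<Sum>j<n. \<bar>real_of_int d\<bar> * (R $$ (i, j) * (if j \<in> S then u $ j else 0)))"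
      by (rule sum_cong) (use y_u R_entry that u_off in auto)
    also have "\<dots> = - \<bar>real_of_int d\<bar>"
      using Au[of i] that by (simp add: sum_distrib_left[symmetric])
    finally show ?thesis .
  qed
  have y_off: "y i = 0" if "i < n" "i \<notin> S" for i
    using y_u[of i] u_off[of i] that by simp
  have y_nonneg: "0 \<le> y i" if "i < n" for i
  proof -
    have "0 \<le> real_of_int (y i)"
      by (rule minimal_negative_imp_nonneg[OF _ _ min, where c = "\<bar>real_of_int d\<bar>"])
        (use sym y_off img that in \<open>auto simp: S_def\<close>)
    then show ?thesis by simp
  qed
  have y_bound: "y i \<le> (\<Prod>i<n. \<Prod>j<n. 1 + \<bar>M $$ (i, j)\<bar>)" for i
  proof -
    have "y i \<le> \<bar>det (replace_col B b i)\<bar>"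
      unfolding y_def by (auto simp: sgn_if abs_ge_self abs_ge_minus_self)
    also have "\<dots> \<le> (\<Prod>i<n. \<Prod>j<n. 1 + \<bar>M $$ (i, j)\<bar>)"
      unfolding B_def by (rule abs_det_replace_col_le[OF M]) (simp add: b_def)
    finally show ?thesis .
  qed
  have "bilinear_form {..<n} ?m (\<lambda>i. real_of_int (y i)) (\<lambda>i. real_of_int (y i))
      = - (\<bar>real_of_int d\<bar> * (\<Sum>i<n. real_of_int (y i)))"
    by (rule bilinear_form_constant_image) (use img y_off in force)
  moreover have "0 < (\<Sum>i<n. real_of_int (y i))"
  proof -
    obtain i where i: "i < n" "i \<in> S"
      using min unfolding minimal_negative_def bilinear_form_def S_def
      by (smt (verit) lessThan_iff mem_Collect_eq mult_eq_0_iff sum.neutral)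
    \<comment> \<open>\<open>y\<close> cannot vanish, since \<open>M y\<close> has the nonzero entry \<open>- \<bar>d\<bar>\<close> at \<open>i\<close>.\<close>
    have "\<exists>j<n. y j \<noteq> 0"
    proof (rule ccontr)
      assume "\<not> (\<exists>j<n. y j \<noteq> 0)"
      then have "(\<Sum>j<n. ?m i j * real_of_int (y j)) = 0" by simp
      with img[OF i] d show False by simp
    qed
    then obtain j where "j < n" "y j \<noteq> 0" by blast
    then show ?thesis
      using y_nonneg by (intro sum_pos2[of _ j]) (auto simp: less_le)
  qed
  ultimately have "bilinear_form {..<n} ?m (\<lambda>i. real_of_int (y i)) (\<lambda>i. real_of_int (y i)) < 0"
    using d by simp
  moreover have "bilinear_form {..<n} ?m (\<lambda>i. real_of_int (y i)) (\<lambda>i. real_of_int (y i))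
      = real_of_int (bilinear_form {..<n} (\<lambda>i j. M $$ (i, j)) y y)"
    unfolding bilinear_form_def by simp
  ultimately have "bilinear_form {..<n} (\<lambda>i j. M $$ (i, j)) y y < 0" by simp
  then show ?thesis using that y_nonneg y_bound by blast
qed

section \<open>Encoding lengths\<close>

lemma rat_enc_length_of_int:
  "rat_enc_length (of_int a) = \<lceil>log 2 (real_of_int (a + 1))\<rceil> + 1"
  unfolding rat_enc_length_def by (simp add: Let_def)

lemma sum_symmetric_le_double_upper_triangle:
  fixes f :: "nat \<Rightarrow> nat \<Rightarrow> int"
  assumes "\<And>i j. i < n \<Longrightarrow> j < n \<Longrightarrow> f i j = f j i"
    and "\<And>i j. i < n \<Longrightarrow> j < n \<Longrightarrow> 0 \<le> f i j"
  shows "(\<Sum>i<n. \<Sum>j<n. f i j) \<le> 2 * (\<Sum>j<n. \<Sum>i\<le>j. f i j)"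
  using assms
proof (induction n)
  case (Suc n)
  have IH: "(\<Sum>i<n. \<Sum>j<n. f i j) \<le> 2 * (\<Sum>j<n. \<Sum>i\<le>j. f i j)"
    using Suc by simp
  have row: "(\<Sum>j<n. f n j) = (\<Sum>i<n. f i n)"
    using Suc.prems(1) by (intro sum.cong) auto
  have "(\<Sum>i\<le>n. f i n) = (\<Sum>i<n. f i n) + f n n"
    by (simp flip: lessThan_Suc_atMost)
  then show ?case
    using IH row Suc.prems(2)[of n n] by (simp add: sum.distrib)
qed simp

text \<open>The product runs over the full matrix, whereas the encoding stores the upper triangle only:
  by symmetry this costs a factor of \<open>2\<close>.\<close>

lemma log_prod_entries_le:
  fixes M :: "int mat"
  assumes M: "M \<in> carrier_mat n n"
    and sym: "\<And>i j. i < n \<Longrightarrow> j < n \<Longrightarrow> M $$ (i, j) = M $$ (j, i)"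
  shows "log 2 (real_of_int (\<Prod>i<n. \<Prod>j<n. 1 + \<bar>M $$ (i, j)\<bar>))
     \<le> real_of_int (2 * (\<Sum>j<n. \<Sum>i\<le>j. \<lceil>log 2 (real_of_int (\<bar>M $$ (i, j)\<bar> + 1))\<rceil>))"
proof -
  let ?w = "\<lambda>i j. \<lceil>log 2 (real_of_int (\<bar>M $$ (i, j)\<bar> + 1))\<rceil>"
  have "log 2 (real_of_int (\<Prod>i<n. \<Prod>j<n. 1 + \<bar>M $$ (i, j)\<bar>))
      = (\<Sum>i<n. \<Sum>j<n. log 2 (real_of_int (\<bar>M $$ (i, j)\<bar> + 1)))"
    by (simp add: log_def ln_prod prod_zero_iff sum_divide_distrib add.commute
        add_pos_nonneg[THEN less_imp_neq, THEN not_sym])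
  also have "\<dots> \<le> (\<Sum>i<n. \<Sum>j<n. real_of_int (?w i j))"
    by (intro sum_mono le_of_int_ceiling)
  also have "\<dots> = real_of_int (\<Sum>i<n. \<Sum>j<n. ?w i j)" by simp
  also have "\<dots> \<le> real_of_int (2 * (\<Sum>j<n. \<Sum>i\<le>j. ?w i j))"
    unfolding of_int_le_iff
  proof (rule sum_symmetric_le_double_upper_triangle)
    show "0 \<le> ?w i j" for i j
    proof -
      have "0 \<le> log 2 (real_of_int (\<bar>M $$ (i, j)\<bar> + 1))" by (subst zero_le_log_cancel_iff) auto
      then show ?thesis by linarith
    qed
  qed (simp add: sym)
  finally show ?thesis .
qed

lemma mat_enc_length_split:
  assumes "M \<in> carrier_mat n n"
  shows "mat_enc_length M =
    (\<Sum>j<n. \<Sum>i\<le>j. \<lceil>log 2 (real_of_int (\<bar>M $$ (i, j)\<bar> + 1))\<rceil>) + (\<Sum>j<n. int j + 1)"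
  using assms unfolding mat_enc_length_def by (simp add: sum.distrib)

theorem theorem2p1:
  fixes n :: nat and M :: "int mat" and L :: int
  assumes "n \<ge> 1"
    and "M \<in> carrier_mat n n"
    and "transpose_mat M = M"
    and "L = mat_enc_length M"
    and "\<exists>x :: real vec. x \<in> carrier_vec n \<and> (\<forall>i<n. x $ i \<ge> 0) \<and>
           x \<bullet> (map_mat of_int M *\<^sub>v x) < 0"
  shows "\<exists>y :: rat vec. y \<in> carrier_vec n \<and> (\<forall>i<n. y $ i \<ge> 0) \<and>
           y \<bullet> (map_mat of_int M *\<^sub>v y) < 0 \<and>
           real_of_int (vec_enc_length y) \<le> 17 * real_of_int L powr (3/2)"
proof -
  have M: "M \<in> carrier_mat n n" by fact
  have sym: "M $$ (i, j) = M $$ (j, i)" if "i < n" "j < n" for i j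
    using M that assms(3) by (metis carrier_matD index_transpose_mat(1))
  have form: "v \<bullet> (map_mat of_int M *\<^sub>v v)
      = bilinear_form {..<n} (\<lambda>i j. of_int (M $$ (i, j))) (\<lambda>i. v $ i) (\<lambda>i. v $ i)"
    if "v \<in> carrier_vec n" for v :: "'a::comm_ring_1 vec"
    using M that unfolding bilinear_form_def scalar_prod_def
    by (auto simp: scalar_prod_def atLeast0LessThan intro!: sum.cong)
  obtain x :: "real vec" where x: "x \<in> carrier_vec n" "\<forall>i<n. x $ i \<ge> 0"
      "x \<bullet> (map_mat of_int M *\<^sub>v x) < 0"
    using assms(5) by blast
  let ?P = "\<Prod>i<n. \<Prod>j<n. 1 + \<bar>M $$ (i, j)\<bar>"
  obtain y :: "nat \<Rightarrow> int" where y: "\<And>i. i < n \<Longrightarrow> 0 \<le> y i" "\<And>i. i < n \<Longrightarrow> y i \<le> ?P"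
      and y_neg: "bilinear_form {..<n} (\<lambda>i j. M $$ (i, j)) y y < 0"
    using bounded_integer_witness[OF M sym, of "\<lambda>i. x $ i"] x form[OF x(1)] by auto
  define Y where "Y = vec n (\<lambda>i. of_int (y i) :: rat)"
  have Y: "Y \<in> carrier_vec n" unfolding Y_def by simp
  have "Y \<bullet> (map_mat of_int M *\<^sub>v Y) = of_int (bilinear_form {..<n} (\<lambda>i j. M $$ (i, j)) y y)"
    unfolding form[OF Y] by (simp add: bilinear_form_def Y_def)
  then have Y_neg: "Y \<bullet> (map_mat of_int M *\<^sub>v Y) < 0"
    using y_neg by simp

  define W where "W = (\<Sum>j<n. \<Sum>i\<le>j. \<lceil>log 2 (real_of_int (\<bar>M $$ (i, j)\<bar> + 1))\<rceil>)"
  have W: "0 \<le> W"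
    unfolding W_def
  proof (intro sum_nonneg)
    fix i j
    have "0 \<le> log 2 (real_of_int (\<bar>M $$ (i, j)\<bar> + 1))" by (subst zero_le_log_cancel_iff) auto
    then show "0 \<le> \<lceil>log 2 (real_of_int (\<bar>M $$ (i, j)\<bar> + 1))\<rceil>" by linarith
  qed
  have L: "L = W + (\<Sum>j<n. int j + 1)"
    unfolding assms(4) W_def by (rule mat_enc_length_split[OF M])
  have gauss: "2 * (\<Sum>j<n. int j + 1) = int n * (int n + 1)"
    by (induction n) (auto simp: algebra_simps)
  have P: "1 \<le> ?P" by (intro prod_ge_1) auto
  \<comment> \<open>The fraction \<open>0/1\<close> of an integer coordinate costs one bit, and passing from \<open>y k\<close> to \<open>y k + 1\<close>
    costs at most another one; for \<open>n \<ge> 1\<close> both are absorbed by the sign bits in \<open>L\<close>.\<close>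
  have coord: "rat_enc_length (Y $ k) \<le> 2 * L" if k: "k < n" for k
  proof -
    have "real_of_int (y k + 1) \<le> real_of_int (2 * ?P)"
      unfolding of_int_le_iff using y(2)[OF k] P by linarith
    then have "log 2 (real_of_int (y k + 1)) \<le> log 2 (real_of_int (2 * ?P))"
      using y(1)[OF k] by (intro log_mono) auto
    also have "\<dots> = 1 + log 2 (real_of_int ?P)"
      using P by (simp only: of_int_mult) (subst log_mult, auto)
    also have "\<dots> \<le> real_of_int (1 + 2 * W)"
      using log_prod_entries_le[OF M sym] unfolding W_def by simp
    finally have "\<lceil>log 2 (real_of_int (y k + 1))\<rceil> \<le> 1 + 2 * W"
      by (rule ceiling_le)
    then have "rat_enc_length (Y $ k) \<le> 2 * (W + 1)"
      using k by (simp add: Y_def rat_enc_length_of_int)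
    moreover have "1 \<le> (\<Sum>j<n. int j + 1)"
      using assms(1) member_le_sum[of 0 "{..<n}" "\<lambda>j. int j + 1"] by simp
    then have "W + 1 \<le> L" using L by linarith
    then have "2 * (W + 1) \<le> 2 * L" by simp
    ultimately show ?thesis by (rule order_trans)
  qed
  have "vec_enc_length Y \<le> (\<Sum>k<n. 2 * L)"
    unfolding vec_enc_length_def carrier_vecD[OF Y] using coord by (intro sum_mono) simp
  then have "real_of_int (vec_enc_length Y) \<le> real_of_int (\<Sum>k<n. 2 * L)"
    unfolding of_int_le_iff .
  then have len: "real_of_int (vec_enc_length Y) \<le> 2 * real n * real_of_int L"
    by (simp add: mult_ac)
  have "0 \<le> L" and "int n * int n \<le> 2 * L"
    using gauss L W by (simp_all add: algebra_simps sum_nonneg)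
  then have L0: "0 \<le> real_of_int L" and "real_of_int (int n * int n) \<le> real_of_int (2 * L)"
    unfolding of_int_le_iff by simp_all
  then have n2: "real n * real n \<le> 2 * real_of_int L" by simp
  have "real n ^ 2 \<le> (2 * sqrt (real_of_int L)) ^ 2"
    using n2 L0 by (simp add: power_mult_distrib power2_eq_square)
  then have n: "real n \<le> 2 * sqrt (real_of_int L)"
    by (rule power2_le_imp_le) (use L0 in simp)
  have "2 * real n * real_of_int L \<le> 2 * (2 * sqrt (real_of_int L)) * real_of_int L"
    using n L0 by (intro mult_right_mono mult_left_mono) auto
  also have "\<dots> = 4 * real_of_int L powr (3/2)"
    using L0 powr_add[of "real_of_int L" 1 "1/2"] by (simp add: powr_half_sqrt)
  finally have "real_of_int (vec_enc_length Y) \<le> 17 * real_of_int L powr (3/2)"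
    using len powr_ge_zero[of "real_of_int L" "3/2"] by linarith
  then show ?thesis
    using Y Y_neg y(1) by (intro exI[of _ Y]) (auto simp: Y_def)
qed

end
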